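(* Let $D=(V,E)$ be a finite directed graph with two distinct distinguished vertices $b$ and $r$ such that from every vertex there is a directed path to at least one of $b,r$. Consider the Richman game on $D$ played by Blue and Red, with the token initially at a vertex $v$, and suppose Blue has a safety ratio (at $v$) strictly greater than $1$. Then Blue has a strategy that wins with probability $1$ and does not require knowledge of Red's money supply. If, moreover, the digraph $D$ is acyclic, then his strategy wins regardless of tiebreaks; that is, "with probability $1$" can be replaced by "definitely".
   Context: Richman game on $D$: two players, Blue and Red, each have a nonnegative real amount of money, the total being positive. A token rests on a vertex of $D$. On each turn, both players simultaneously and secretly bid a nonnegative real number no larger than the amount of money they currently have; the bids are then revealed. The higher bidder pays the amount of his or her bid to the opponent and moves the token from its current vertex along an arc of $D$ to a successor vertex of his or her choice. If the bids are equal, a fair coin toss (the tiebreak) decides who is treated as the higher bidder. The game ends when the token reaches $b$ (Blue wins) or $r$ (Red wins); a token located at $b$ (resp. $r$) at the start means that Blue (resp. Red) has already won. If neither $b$ nor $r$ is ever reached, the game is a draw. Money has no value at the end of the game. For $v\in V$ let $S(v)=\{w\in V:(v,w)\in E\}$. The Richman cost function of $D$ is the (unique) function $R\colon V\to[0,1]$ with $R(b)=0$, $R(r)=1$, and $R(v)=\frac12\left(\max_{w\in S(v)}R(w)+\min_{u\in S(v)}R(u)\right)$ for every $v\in V\setminus\{b,r\}$. Blue's safety ratio at $v$ is the fraction of the total money (Blue's plus Red's) that Blue has in his possession, divided by $R(v)$. A strategy for Blue that does not require knowledge of Red's money supply is a policy for bidding and moving that may depend on $D$, the token's position, Blue's own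 money and the observed history of play (bids, moves, tiebreak outcomes), but not on the amount of money Red has. The same strategy must work whatever Red's actual amount of money is, so long as Blue's safety ratio is strictly greater than $1$. "Wins with probability $1$" means that against any play by Red, Blue wins with probability $1$ with respect to the coin tosses; "definitely" means that Blue wins against any play by Red and for every outcome of the coin tosses. *)

theory Defs
  imports "HOL-Probability.Probability"
begin

definition succs :: "'v set \<Rightarrow> ('v \<times> 'v) set \<Rightarrow> 'v \<Rightarrow> 'v set" where
  "succs V E v = {w \<in> V. (v, w) \<in> E}"

definition richman_cost_function ::
  "'v set \<Rightarrow> ('v \<times> 'v) set \<Rightarrow> 'v \<Rightarrow> 'v \<Rightarrow> ('v \<Rightarrow> real) \<Rightarrow> bool" where
  "richman_cost_function V E b r R \<longleftrightarrow>
     (\<forall>v\<in>V. 0 \<le> R v \<and> R v \<le> 1) \<and> R b = 0 \<and> R r = 1 \<and>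
     (\<forall>v\<in>V - {b, r}. R v = (Max (R ` succs V E v) + Min (R ` succs V E v)) / 2)"

(* Extended-real division: the ratio is \<infinity> when R v = 0 and Blue has money,
   and 0 when R v = 0 and Blue has none. *)
definition safety_ratio :: "('v \<Rightarrow> real) \<Rightarrow> 'v \<Rightarrow> real \<Rightarrow> real \<Rightarrow> ereal" where
  "safety_ratio R v B M = ereal (B / (B + M)) / ereal (R v)"

(* The public record of one turn: starting vertex, the two bids, the outcome of the
   tiebreak (None if the bids differ, Some True if the toss favours Blue), end vertex. *)
datatype 'v turn = Turn
  (turn_from: 'v) (turn_blue_bid: real) (turn_red_bid: real)
  (turn_tiebreak: "bool option") (turn_to: 'v)

(* Both components see the token's position, the player's own money before bidding, and
   the record of all previous turns. The choice of move is made after the bids are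
   revealed, so it may also depend on Blue's bid, Red's bid and the tiebreak of this turn.
   The opponent's money is not an argument. *)
datatype 'v strategy = Strategy
  (bid: "'v \<Rightarrow> real \<Rightarrow> 'v turn list \<Rightarrow> real")
  (move: "'v \<Rightarrow> real \<Rightarrow> 'v turn list \<Rightarrow> real \<Rightarrow> real \<Rightarrow> bool option \<Rightarrow> 'v")

definition legal_strategy ::
  "'v set \<Rightarrow> ('v \<times> 'v) set \<Rightarrow> 'v \<Rightarrow> 'v \<Rightarrow> 'v strategy \<Rightarrow> bool" where
  "legal_strategy V E b r s \<longleftrightarrow>
     (\<forall>v\<in>V - {b, r}. \<forall>m\<ge>0. \<forall>h.
        0 \<le> bid s v m h \<and> bid s v m h \<le> m \<and>
        (\<forall>x y t. move s v m h x y t \<in> succs V E v))"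

datatype 'v state = State
  (token: 'v) (blue_money: real) (red_money: real) (history: "'v turn list")

(* One turn, with c the coin used if the bids are equal (True favours Blue).
   The game is frozen once the token is at b or r. *)
definition play_turn ::
  "'v \<Rightarrow> 'v \<Rightarrow> 'v strategy \<Rightarrow> 'v strategy \<Rightarrow> bool \<Rightarrow> 'v state \<Rightarrow> 'v state" where
  "play_turn b r \<sigma> \<rho> c s =
     (let v = token s; B = blue_money s; M = red_money s; h = history s in
      if v = b \<or> v = r then s
      else
        let x = bid \<sigma> v B h;
            y = bid \<rho> v M h;
            t = (if x = y then Some c else None)
        in if x > y \<or> (x = y \<and> c)
           then let w = move \<sigma> v B h x y t
                in State w (B - x) (M + x) (h @ [Turn v x y t w])
           else let w = move \<rho> v M h x y t
                in State w (B + y) (M - y) (h @ [Turn v x y t w]))"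

primrec play ::
  "'v \<Rightarrow> 'v \<Rightarrow> 'v strategy \<Rightarrow> 'v strategy \<Rightarrow> 'v state \<Rightarrow> (nat \<Rightarrow> bool) \<Rightarrow> nat \<Rightarrow> 'v state" where
  "play b r \<sigma> \<rho> s \<omega> 0 = s"
| "play b r \<sigma> \<rho> s \<omega> (Suc n) = play_turn b r \<sigma> \<rho> (\<omega> n) (play b r \<sigma> \<rho> s \<omega> n)"

(* As play is frozen at r, reaching b entails that r was not reached before. *)
definition blue_wins ::
  "'v \<Rightarrow> 'v \<Rightarrow> 'v strategy \<Rightarrow> 'v strategy \<Rightarrow> 'v \<Rightarrow> real \<Rightarrow> real \<Rightarrow> (nat \<Rightarrow> bool) \<Rightarrow> bool" where
  "blue_wins b r \<sigma> \<rho> v B M \<omega> \<longleftrightarrow> (\<exists>n. token (play b r \<sigma> \<rho> (State v B M []) \<omega> n) = b)"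

(* One toss is drawn for every turn and ignored (and unobserved by the players)
   in turns without a tie. *)
definition coin_tosses :: "(nat \<Rightarrow> bool) measure" where
  "coin_tosses = Pi\<^sub>M UNIV (\<lambda>_. measure_pmf (bernoulli_pmf (1/2)))"

definition wins_with_probability_1 ::
  "'v set \<Rightarrow> ('v \<times> 'v) set \<Rightarrow> 'v \<Rightarrow> 'v \<Rightarrow> 'v strategy \<Rightarrow> 'v \<Rightarrow> real \<Rightarrow> real \<Rightarrow> bool" where
  "wins_with_probability_1 V E b r \<sigma> v B M \<longleftrightarrow>
     (\<forall>\<rho>. legal_strategy V E b r \<rho> \<longrightarrow>
        (AE \<omega> in coin_tosses. blue_wins b r \<sigma> \<rho> v B M \<omega>))"

definition wins_definitely ::
  "'v set \<Rightarrow> ('v \<times> 'v) set \<Rightarrow> 'v \<Rightarrow> 'v \<Rightarrow> 'v strategy \<Rightarrow> 'v \<Rightarrow> real \<Rightarrow> real \<Rightarrow> bool" where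
  "wins_definitely V E b r \<sigma> v B M \<longleftrightarrow>
     (\<forall>\<rho>. legal_strategy V E b r \<rho> \<longrightarrow> (\<forall>\<omega>. blue_wins b r \<sigma> \<rho> v B M \<omega>))"

end

theory Submission
  imports Defs
begin

text \<open>
  Let \<open>v\<^sub>0\<close> be the initial vertex and put \<open>F = B / R v\<^sub>0\<close>. This is the total amount of money
  for which Blue would have safety ratio exactly \<open>1\<close>; that the true ratio exceeds \<open>1\<close> means
  that the true total \<open>T\<close> is smaller than \<open>F\<close>. Blue knows \<open>F\<close> but not \<open>T\<close>, and he plays as if
  the total were \<open>F\<close>. Call \<open>B - R v * F\<close> his surplus when he holds \<open>B\<close> and the token is at \<open>v\<close>;
  initially it is \<open>0\<close>. Bidding \<open>(max - min) / 2 * F\<close>, where the extremes are those of \<open>R\<close> over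
  the successors, and moving to a successor of minimal cost never decreases the surplus: if he
  wins, his payment is exactly covered by the drop in \<open>R\<close>, and if he loses, he receives at least
  what the rise in \<open>R\<close> demands. As long as the surplus is nonnegative, the token is not at \<open>r\<close>,
  because there Blue would hold \<open>F > T\<close>. If \<open>E\<close> is acyclic this suffices, since the token must
  stop somewhere.

  If there are cycles, Red could keep the token away from \<open>b\<close> by overbidding by tiny amounts
  forever. So Blue adds to his bid a fraction \<open>2 / 8^d\<close> of his surplus, where \<open>d\<close> is the distance
  to \<open>b\<close> along arcs to successors of minimal cost (\<open>greedy_dist\<close>), and he moves along such arcs.
  The stake grows steeply as the token approaches \<open>b\<close>, so one bid won by Red returns to
  Blue more than he has staked on the approach. A single potential,
  \<open>surplus * (1 + 1 / 8^d)\<close>, makes this precise: every turn, whoever wins it, multiplies it by at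
  least a constant greater than \<open>1\<close> (\<open>potential_grows\<close>). It is also bounded, so once the surplus is
  positive, Blue wins without any luck (\<open>positive_surplus_wins\<close>).

  There remain the plays in which the surplus is always \<open>0\<close>. In these Red never overbids, so Blue
  makes every move for which the coin favours him, and a run of such tosses longer than the
  largest greedy distance takes the token to \<open>b\<close> (\<open>run_of_heads_wins\<close>). Such a run occurs almost
  surely (\<open>AE_coin_tosses_run\<close>).

  If \<open>R v\<^sub>0 = 0\<close>, then all vertices that the token can visit have cost \<open>0\<close>. Here \<open>F\<close> is
  irrelevant to the bids, \<open>r\<close> is out of reach, and all of Blue's money is surplus.
\<close>

section \<open>Costs of successors and greedy paths\<close>

locale richman_digraph =
  fixes V :: "'v set" and E :: "('v \<times> 'v) set" and b r :: 'v and R :: "'v \<Rightarrow> real"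
  assumes finite_V: "finite V" and E_subset: "E \<subseteq> V \<times> V"
    and reaches_end: "\<And>w. w \<in> V \<Longrightarrow> (w, b) \<in> E\<^sup>* \<or> (w, r) \<in> E\<^sup>*"
    and cost_function: "richman_cost_function V E b r R"
begin

definition min_cost :: "'v \<Rightarrow> real" where
  "min_cost v = Min (R ` succs V E v)"

definition max_cost :: "'v \<Rightarrow> real" where
  "max_cost v = Max (R ` succs V E v)"

definition half_spread :: "'v \<Rightarrow> real" where
  "half_spread v = (max_cost v - min_cost v) / 2"

lemma R_r: "R r = 1"
  using cost_function by (auto simp: richman_cost_function_def)

lemma R_bounds: "w \<in> V \<Longrightarrow> 0 \<le> R w \<and> R w \<le> 1"
  using cost_function by (auto simp: richman_cost_function_def)

lemma succs_subset: "succs V E v \<subseteq> V" and finite_succs: "finite (succs V E v)"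
  using finite_V by (auto simp: succs_def)

lemma succs_nonempty:
  assumes "v \<in> V - {b, r}"
  shows "succs V E v \<noteq> {}"
proof -
  from assms reaches_end[of v] have "\<exists>w. (v, w) \<in> E"
    by (auto elim: converse_rtranclE)
  then show ?thesis
    using E_subset by (auto simp: succs_def)
qed

lemma min_cost_le: "w \<in> succs V E v \<Longrightarrow> min_cost v \<le> R w"
  and le_max_cost: "w \<in> succs V E v \<Longrightarrow> R w \<le> max_cost v"
  by (auto simp: min_cost_def max_cost_def finite_succs)

lemma ex_min_cost_succ:
  assumes "v \<in> V - {b, r}"
  shows "\<exists>w \<in> succs V E v. R w = min_cost v"
proof -
  have "min_cost v \<in> R ` succs V E v"
    unfolding min_cost_def by (rule Min_in) (use succs_nonempty[OF assms] finite_succs in auto)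
  then show ?thesis by force
qed

lemma R_average:
  assumes "v \<in> V - {b, r}"
  shows "R v = min_cost v + half_spread v" "R v = max_cost v - half_spread v"
proof -
  have "R v = (max_cost v + min_cost v) / 2"
    using cost_function assms unfolding richman_cost_function_def min_cost_def max_cost_def by blast
  then show "R v = min_cost v + half_spread v" "R v = max_cost v - half_spread v"
    by (simp_all add: half_spread_def field_simps)
qed

lemma min_cost_nonneg:
  assumes "v \<in> V - {b, r}"
  shows "0 \<le> min_cost v"
  using ex_min_cost_succ[OF assms] R_bounds succs_subset by force

lemma half_spread_nonneg:
  assumes "v \<in> V - {b, r}"
  shows "0 \<le> half_spread v"
  using ex_min_cost_succ[OF assms] le_max_cost by (force simp: half_spread_def)

text \<open>The arcs along which Blue moves.\<close>

definition greedy :: "('v \<times> 'v) set" where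
  "greedy = {(v, w). v \<in> V - {b, r} \<and> w \<in> succs V E v \<and> R w = min_cost v}"

text \<open>
  Among the vertices that greedy arcs reach from \<open>v\<close>, consider those of minimal cost \<open>c\<close>. A greedy
  step cannot lower the cost of such a vertex, and then the averaging property forces all its
  successors to have cost \<open>c\<close>. So this set is closed under all arcs until \<open>b\<close> is reached, and
  it does not contain \<open>r\<close>, whose cost is \<open>1\<close>. Hence the path to \<open>b\<close> or \<open>r\<close> that the hypothesis on
  the digraph provides stays inside this set and ends at \<open>b\<close>.
\<close>

lemma greedy_reaches_b:
  assumes "v \<in> V" "R v < 1"
  shows "(v, b) \<in> greedy\<^sup>*"
proof -
  define A where "A = {w. (v, w) \<in> greedy\<^sup>*}"
  have "A \<subseteq> V"
  proof
    fix w assume "w \<in> A"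
    then have "(v, w) \<in> greedy\<^sup>*" by (simp add: A_def)
    then show "w \<in> V"
      by (induction rule: rtrancl_induct) (use assms succs_subset in \<open>auto simp: greedy_def\<close>)
  qed
  then have finA: "finite A" using finite_V finite_subset by blast
  have vA: "v \<in> A" by (simp add: A_def)
  define c where "c = Min (R ` A)"
  have c_le: "c \<le> R w" if "w \<in> A" for w
    using that finA by (simp add: c_def)
  then have "c < 1" using vA assms by force
  have "c \<in> R ` A" unfolding c_def by (rule Min_in) (use finA vA in auto)
  then obtain u where u: "u \<in> A" "R u = c" by force
  have closed: "y \<in> A \<and> R y = c" if "x \<in> A" "R x = c" "(x, y) \<in> E" "x \<noteq> b" for x y
  proof -
    have x: "x \<in> V - {b, r}" using that \<open>A \<subseteq> V\<close> \<open>c < 1\<close> R_r by auto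
    obtain w where w: "w \<in> succs V E x" "R w = min_cost x" using ex_min_cost_succ[OF x] by blast
    then have "(x, w) \<in> greedy" using x by (simp add: greedy_def)
    then have "w \<in> A" using \<open>x \<in> A\<close> by (auto simp: A_def)
    \<comment> \<open>The minimum over the successors is at least \<open>c\<close> while the average of the extremes is
        \<open>c\<close>, so all successors have cost \<open>c\<close> and all arcs leaving \<open>x\<close> are greedy.\<close>
    then have "c \<le> min_cost x" using c_le[of w] w(2) by simp
    moreover have "min_cost x + half_spread x = c" "max_cost x - half_spread x = c" "0 \<le> half_spread x"
      using R_average[OF x] half_spread_nonneg[OF x] that by auto
    moreover have ys: "y \<in> succs V E x" using that E_subset by (auto simp: succs_def)
    ultimately have "R y = c" "R y = min_cost x" using min_cost_le[OF ys] le_max_cost[OF ys] by linarith+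
    then have "(x, y) \<in> greedy" using x ys by (simp add: greedy_def)
    then have "y \<in> A" using \<open>x \<in> A\<close> by (auto simp: A_def)
    then show ?thesis using \<open>R y = c\<close> by simp
  qed
  have "b \<in> A" if "(x, t) \<in> E\<^sup>*" "x \<in> A" "R x = c" "t = b \<or> t = r" for x t
    using that
  proof (induction rule: converse_rtrancl_induct)
    case base
    then show ?case using \<open>c < 1\<close> R_r by auto
  next
    case (step x y)
    then show ?case using closed[of x y] by (cases "x = b") auto
  qed
  then have "b \<in> A" using u reaches_end[of u] \<open>A \<subseteq> V\<close> by blast
  then show ?thesis by (simp add: A_def)
qed

definition greedy_dist :: "'v \<Rightarrow> nat" where
  "greedy_dist v = (LEAST n. (v, b) \<in> greedy ^^ n)"

lemma ex_greedy_step: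
  assumes v: "v \<in> V - {b, r}" and "R v < 1"
  shows "\<exists>w \<in> succs V E v. R w = min_cost v \<and> greedy_dist w < greedy_dist v"
proof -
  have "\<exists>n. (v, b) \<in> greedy ^^ n"
    using greedy_reaches_b assms by (auto simp: rtrancl_power)
  then have d: "(v, b) \<in> greedy ^^ greedy_dist v"
    unfolding greedy_dist_def by (rule LeastI_ex)
  then have "greedy_dist v \<noteq> 0" using v by (auto intro: ccontr)
  then obtain k where k: "greedy_dist v = Suc k" using not0_implies_Suc by blast
  then obtain w where w: "(v, w) \<in> greedy" "(w, b) \<in> greedy ^^ k"
    using d relpow_Suc_D2 by metis
  from w(2) have "greedy_dist w \<le> k" unfolding greedy_dist_def by (rule Least_le)
  then show ?thesis using w(1) k by (auto simp: greedy_def)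
qed

definition dist_bound :: nat where
  "dist_bound = Max (greedy_dist ` V)"

lemma greedy_dist_le: "v \<in> V \<Longrightarrow> greedy_dist v \<le> dist_bound"
  using finite_V by (simp add: dist_bound_def)

text \<open>
  At vertices of cost \<open>1\<close> the move is an arbitrary successor, for legality alone: a safe play never
  visits them.
\<close>

definition greedy_move :: "'v \<Rightarrow> 'v" where
  "greedy_move v = (SOME w. w \<in> succs V E v \<and>
     (R v < 1 \<longrightarrow> R w = min_cost v \<and> greedy_dist w < greedy_dist v))"

lemma greedy_move:
  assumes "v \<in> V - {b, r}"
  shows "greedy_move v \<in> succs V E v"
    and "R v < 1 \<Longrightarrow> R (greedy_move v) = min_cost v"
    and "R v < 1 \<Longrightarrow> greedy_dist (greedy_move v) < greedy_dist v"
proof -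
  have "\<exists>w. w \<in> succs V E v \<and> (R v < 1 \<longrightarrow> R w = min_cost v \<and> greedy_dist w < greedy_dist v)"
    using ex_greedy_step[OF assms] succs_nonempty[OF assms] by blast
  then have "greedy_move v \<in> succs V E v \<and> (R v < 1 \<longrightarrow>
      R (greedy_move v) = min_cost v \<and> greedy_dist (greedy_move v) < greedy_dist v)"
    unfolding greedy_move_def by (rule someI_ex)
  then show "greedy_move v \<in> succs V E v"
    "R v < 1 \<Longrightarrow> R (greedy_move v) = min_cost v"
    "R v < 1 \<Longrightarrow> greedy_dist (greedy_move v) < greedy_dist v" by auto
qed

section \<open>The strategy and its effect in one turn\<close>

definition stake :: "'v \<Rightarrow> real" where
  "stake v = 2 / 8 ^ greedy_dist v"

text \<open>
  The bid is truncated to \<open>[0, m]\<close> only to make the strategy legal in positions that do not occur;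
  in safe states the truncation has no effect.
\<close>

definition cautious_strategy :: "real \<Rightarrow> 'v strategy" where
  "cautious_strategy F = Strategy
     (\<lambda>v m h. max 0 (min m (half_spread v * F + stake v * (m - R v * F))))
     (\<lambda>v m h x y t. greedy_move v)"

lemma legal_cautious_strategy: "legal_strategy V E b r (cautious_strategy F)"
  by (auto simp: legal_strategy_def cautious_strategy_def greedy_move(1))

text \<open>Blue's money beyond what safety ratio \<open>1\<close> requires when the total is taken to be \<open>F\<close>.\<close>

definition surplus :: "real \<Rightarrow> 'v state \<Rightarrow> real" where
  "surplus F s = blue_money s - R (token s) * F"

text \<open>
  The invariant of the play. Its last conjunct keeps the token away from \<open>r\<close>: if \<open>T < F\<close>,
  a nonnegative surplus excludes cost \<open>1\<close>, and from a vertex of cost \<open>0\<close> only such vertices can be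
  reached.
\<close>

definition safe :: "real \<Rightarrow> real \<Rightarrow> 'v state \<Rightarrow> bool" where
  "safe F T s \<longleftrightarrow> token s \<in> V \<and> 0 \<le> blue_money s \<and> 0 \<le> red_money s \<and>
     blue_money s + red_money s = T \<and> 0 \<le> surplus F s \<and> (T < F \<or> R (token s) = 0)"

lemma safe_cost_less_1:
  assumes "safe F T s" "0 \<le> F"
  shows "R (token s) < 1"
proof (cases "R (token s) = 0")
  case False
  then have "R (token s) * F \<le> T" "T < F" "0 \<le> T"
    using assms by (auto simp: safe_def surplus_def)
  then have "R (token s) * F < 1 * F" by linarith
  then show ?thesis using \<open>T < F\<close> \<open>0 \<le> T\<close> by (simp add: mult_less_cancel_right)
qed simp

text \<open>
  In the last conclusion the first alternative is that Blue moves and the second that Red does. A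
  coin in Blue's favour turns ties into moves by Blue, so Red then moves only by strictly
  overbidding, and the excess goes to the surplus even when the stake is \<open>0\<close>.
\<close>

lemma turn_outcome:
  assumes safe: "safe F T s" and F: "0 \<le> F" and nb: "token s \<noteq> b"
    and legal: "legal_strategy V E b r \<rho>"
    and s': "s' = play_turn b r (cautious_strategy F) \<rho> c s"
  shows "safe F T s'" and "(token s, token s') \<in> E" and "0 < greedy_dist (token s)"
    and "greedy_dist (token s') < greedy_dist (token s) \<and>
           surplus F s' = surplus F s - stake (token s) * surplus F s \<or>
         surplus F s' \<ge> surplus F s + stake (token s) * surplus F s \<and>
           (c \<longrightarrow> surplus F s' > surplus F s)"
proof -
  let ?v = "token s" and ?B = "blue_money s" and ?M = "red_money s" and ?S = "surplus F s"
  have less1: "R ?v < 1" using safe_cost_less_1[OF safe F] .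
  have v: "?v \<in> V - {b, r}" using safe nb less1 R_r by (auto simp: safe_def)
  note B = safe[unfolded safe_def]
  show dpos: "0 < greedy_dist ?v" using greedy_move(3)[OF v less1] by simp
  have stake: "0 \<le> stake ?v" "stake ?v \<le> 1"
  proof -
    have "(8::real) ^ 1 \<le> 8 ^ greedy_dist ?v" using dpos by (intro power_increasing) auto
    then show "0 \<le> stake ?v" "stake ?v \<le> 1" by (auto simp: stake_def field_simps)
  qed
  \<comment> \<open>Blue's bid, before it is known that the truncation has no effect, and Red's bid.\<close>
  define x where "x = half_spread ?v * F + stake ?v * ?S"
  define y where "y = bid \<rho> ?v ?M (history s)"
  have S: "0 \<le> ?S" "?B = R ?v * F + ?S" using B by (auto simp: surplus_def)
  have x0: "0 \<le> x" using S stake half_spread_nonneg[OF v] F by (simp add: x_def)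
  have xB: "x \<le> ?B"
  proof -
    have "half_spread ?v * F \<le> R ?v * F"
      using R_average(1)[OF v] min_cost_nonneg[OF v] F by (intro mult_right_mono) auto
    moreover have "stake ?v * ?S \<le> 1 * ?S" using S stake by (intro mult_right_mono) auto
    ultimately show ?thesis using S by (simp add: x_def)
  qed
  have bid: "bid (cautious_strategy F) ?v ?B (history s) = x"
    using x0 xB by (simp add: cautious_strategy_def x_def surplus_def)
  have blue_move: "move (cautious_strategy F) ?v ?B h p q t = greedy_move ?v" for h p q t
    by (simp add: cautious_strategy_def)
  have y: "0 \<le> y" "y \<le> ?M"
    and red_move: "\<And>p q t. move \<rho> ?v ?M (history s) p q t \<in> succs V E ?v"
    using legal v B unfolding legal_strategy_def y_def by blast+
  \<comment> \<open>Costs are nonnegative and average to \<open>R ?v\<close>, so cost \<open>0\<close> is passed on to all successors.\<close>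
  have zero: "R w = 0" if "R ?v = 0" "w \<in> succs V E ?v" for w
    using that R_average[OF v] min_cost_nonneg[OF v] half_spread_nonneg[OF v] min_cost_le[OF that(2)]
      le_max_cost[OF that(2)] by linarith
  consider
    (blue) "x \<ge> y" "token s' = greedy_move ?v" "blue_money s' = ?B - x" "red_money s' = ?M + x"
  | (red) "y \<ge> x" "c \<longrightarrow> y > x" "token s' \<in> succs V E ?v" "blue_money s' = ?B + y"
      "red_money s' = ?M - y"
  proof (cases "x > y \<or> (x = y \<and> c)")
    case True
    then show ?thesis
      using v by (intro blue) (auto simp: s' play_turn_def Let_def bid blue_move y_def[symmetric])
  next
    case False
    then show ?thesis
      using v red_move
      by (intro red) (auto simp: s' play_turn_def Let_def bid y_def[symmetric])
  qed
  note outcome = this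
  have main: "safe F T s' \<and> token s' \<in> succs V E ?v \<and>
     (greedy_dist (token s') < greedy_dist ?v \<and> surplus F s' = ?S - stake ?v * ?S \<or>
      surplus F s' \<ge> ?S + stake ?v * ?S \<and> (c \<longrightarrow> surplus F s' > ?S))"
    using outcome
  proof cases
    case blue
    note w = greedy_move[OF v]
    have sur: "surplus F s' = ?S - stake ?v * ?S"
      using blue S w(2)[OF less1] R_average(1)[OF v]
      by (simp add: surplus_def[of _ s'] x_def algebra_simps)
    moreover have "stake ?v * ?S \<le> 1 * ?S" using S stake by (intro mult_right_mono) auto
    ultimately have "safe F T s'"
      using blue B y x0 xB zero w(1) succs_subset[of ?v] by (auto simp: safe_def)
    then show ?thesis using sur w less1 blue by auto
  next
    case red
    have "R (token s') * F \<le> max_cost ?v * F"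
      using le_max_cost red F by (intro mult_right_mono) auto
    moreover have "max_cost ?v = R ?v + half_spread ?v"
      using R_average(2)[OF v] by simp
    then have "max_cost ?v * F = R ?v * F + half_spread ?v * F"
      by (simp only: distrib_right)
    ultimately have sur: "surplus F s' \<ge> ?S + stake ?v * ?S + (y - x)"
      using red S by (simp add: surplus_def[of _ s'] x_def)
    moreover have "0 \<le> stake ?v * ?S" using S stake by simp
    ultimately have "safe F T s'"
      using red B y x0 xB zero succs_subset[of ?v] S by (auto simp: safe_def)
    then show ?thesis using sur red \<open>0 \<le> stake ?v * ?S\<close> by auto
  qed
  then show "safe F T s'" "(?v, token s') \<in> E"
    "greedy_dist (token s') < greedy_dist ?v \<and> surplus F s' = ?S - stake ?v * ?S \<or>
      surplus F s' \<ge> ?S + stake ?v * ?S \<and> (c \<longrightarrow> surplus F s' > ?S)"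
    by (auto simp: succs_def)
qed

section \<open>The growing potential\<close>

definition potential :: "real \<Rightarrow> 'v state \<Rightarrow> real" where
  "potential F s = surplus F s * (1 + 1 / 8 ^ greedy_dist (token s))"

definition growth :: real where
  "growth = 1 + 1 / (2 * 8 ^ dist_bound)"

text \<open>
  Write \<open>e = 1 / 8^d\<close>, so that the stake is \<open>2 * e\<close> and, as \<open>d\<close> is positive, \<open>e \<le> 1 / 8\<close>. If Red
  moves, the surplus gains the factor \<open>1 + 2 * e\<close>, which beats the present weight \<open>1 + e\<close>
  wherever the token goes. If Blue moves, the surplus is multiplied by \<open>1 - 2 * e\<close> but the weight
  rises to at least \<open>1 + 8 * e\<close>, and \<open>(1 - 2 * e) * (1 + 8 * e) \<ge> 1 + 2 * e\<close> as well. In both cases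
  the new potential is at least \<open>1 + 2 * e \<ge> (1 + e / 2) * (1 + e)\<close> times the surplus.
\<close>

lemma potential_grows:
  assumes safe: "safe F T s" and F: "0 \<le> F" and nb: "token s \<noteq> b"
    and legal: "legal_strategy V E b r \<rho>"
    and s': "s' = play_turn b r (cautious_strategy F) \<rho> c s"
  shows "growth * potential F s \<le> potential F s'"
proof -
  note t = turn_outcome[OF assms]
  define e where "e = 1 / (8::real) ^ greedy_dist (token s)"
  define e' where "e' = 1 / (8::real) ^ greedy_dist (token s')"
  let ?S = "surplus F s"
  have S: "0 \<le> ?S" and tV: "token s \<in> V" using safe by (auto simp: safe_def)
  have e: "0 < e" "e \<le> 1 / 8"
  proof -
    have "(8::real) ^ 1 \<le> 8 ^ greedy_dist (token s)" using t(3) by (intro power_increasing) auto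
    then show "0 < e" "e \<le> 1 / 8" by (auto simp: e_def field_simps)
  qed
  have "(8::real) ^ greedy_dist (token s) \<le> 8 ^ dist_bound"
    using greedy_dist_le[OF tV] by (intro power_increasing) auto
  then have g: "growth \<le> 1 + e / 2" by (simp add: growth_def e_def field_simps)
  have stake: "stake (token s) = 2 * e" by (simp add: stake_def e_def)
  have pot: "potential F s = ?S * (1 + e)" "potential F s' = surplus F s' * (1 + e')"
    by (simp_all add: potential_def e_def e'_def)
  have e'0: "0 \<le> e'" by (simp add: e'_def)
  have ee: "0 \<le> e * e" "e * e \<le> e / 8"
    using mult_left_mono[OF e(2), of e] e by auto
  have lower: "(1 + e / 2) * (1 + e) \<le> 1 + 2 * e"
    using ee e by (simp add: algebra_simps)
  have "growth * potential F s \<le> (1 + e / 2) * (?S * (1 + e))"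
    unfolding pot using g S e by (intro mult_right_mono) auto
  also have "\<dots> \<le> ?S * (1 + 2 * e)"
    using mult_left_mono[OF lower S] by (simp add: mult_ac)
  also have "\<dots> \<le> potential F s'"
    using t(4)
  proof (elim disjE conjE)
    assume d: "greedy_dist (token s') < greedy_dist (token s)"
      and sur: "surplus F s' = ?S - stake (token s) * ?S"
    have "(8::real) ^ (greedy_dist (token s') + 1) \<le> 8 ^ greedy_dist (token s)"
      using d by (intro power_increasing) auto
    then have e': "8 * e \<le> e'" by (simp add: e_def e'_def field_simps)
    have "1 + 2 * e \<le> (1 - 2 * e) * (1 + 8 * e)" using ee e by (simp add: algebra_simps)
    also have "\<dots> \<le> (1 - 2 * e) * (1 + e')" using e' e by (intro mult_left_mono) auto
    finally have "?S * (1 + 2 * e) \<le> ?S * ((1 - 2 * e) * (1 + e'))"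
      using S by (rule mult_left_mono)
    then show ?thesis by (simp add: pot sur stake algebra_simps)
  next
    assume "surplus F s' \<ge> ?S + stake (token s) * ?S"
    then have *: "?S * (1 + 2 * e) \<le> surplus F s'" by (simp add: stake algebra_simps)
    moreover have "0 \<le> ?S * (1 + 2 * e)" using S e by simp
    ultimately have "surplus F s' * 1 \<le> surplus F s' * (1 + e')"
      using e'0 by (intro mult_left_mono) auto
    then show ?thesis using * pot by simp
  qed
  finally show ?thesis .
qed

section \<open>Winning a play\<close>

context
  fixes F T :: real and \<rho> :: "'v strategy" and s\<^sub>0 :: "'v state" and \<omega> :: "nat \<Rightarrow> bool"
    and st :: "nat \<Rightarrow> 'v state"
  defines "st \<equiv> play b r (cautious_strategy F) \<rho> s\<^sub>0 \<omega>"
  assumes F_nonneg: "0 \<le> F" and start_safe: "safe F T s\<^sub>0"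
    and red_legal: "legal_strategy V E b r \<rho>"
begin

lemma st_Suc: "st (Suc n) = play_turn b r (cautious_strategy F) \<rho> (\<omega> n) (st n)"
  by (simp add: st_def)

lemma play_safe: "safe F T (st n)"
proof (induction n)
  case 0
  then show ?case using start_safe by (simp add: st_def)
next
  case (Suc n)
  show ?case
  proof (cases "token (st n) = b")
    case True
    then show ?thesis using Suc by (simp add: st_Suc play_turn_def Let_def)
  next
    case False
    then show ?thesis using turn_outcome(1)[OF Suc F_nonneg _ red_legal st_Suc] by simp
  qed
qed

text \<open>
  Until \<open>b\<close> is reached the potential grows geometrically, but it never exceeds \<open>2 * T\<close>, as the
  surplus is part of the money in play.
\<close>

lemma positive_surplus_wins:
  assumes "0 < surplus F (st n)"
  shows "\<exists>k. token (st k) = b"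
proof (rule ccontr)
  assume never: "\<nexists>k. token (st k) = b"
  let ?P = "potential F (st n)"
  have P: "0 < ?P" using assms by (simp add: potential_def add_pos_pos)
  have grow: "growth ^ k * ?P \<le> potential F (st (n + k))" for k
  proof (induction k)
    case (Suc k)
    have "growth * (growth ^ k * ?P) \<le> growth * potential F (st (n + k))"
      using Suc by (intro mult_left_mono) (auto simp: growth_def)
    also have "\<dots> \<le> potential F (st (n + Suc k))"
      using potential_grows[OF play_safe F_nonneg _ red_legal st_Suc] never by simp
    finally show ?case by (simp add: mult_ac)
  qed simp
  have bound: "potential F s \<le> T * 2" if "safe F T s" for s
  proof -
    have "0 \<le> R (token s) * F" using that F_nonneg R_bounds by (auto simp: safe_def)
    then have "surplus F s \<le> T" "0 \<le> surplus F s" using that by (auto simp: safe_def surplus_def)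
    then show ?thesis unfolding potential_def by (intro mult_mono) auto
  qed
  have "1 < growth" by (simp add: growth_def)
  then obtain k where "T * 2 / ?P < growth ^ k" using real_arch_pow by blast
  then have "T * 2 < growth ^ k * ?P" using P by (simp add: field_simps)
  then show False using grow[of k] bound[OF play_safe, of "n + k"] by linarith
qed

text \<open>
  If Blue does not win, his surplus stays \<open>0\<close> by the previous lemma. A move by Red during the
  run would make it positive, so Blue makes all moves of the run, each of which lowers the greedy
  distance; but the run is longer than that distance.
\<close>

lemma run_of_heads_wins:
  assumes run: "\<And>i. i \<le> dist_bound \<Longrightarrow> \<omega> (m + i)"
  shows "\<exists>k. token (st k) = b"
proof (rule ccontr)
  assume never: "\<nexists>k. token (st k) = b"
  have no_surplus: "surplus F (st k) = 0" for k
    using positive_surplus_wins[of k] never play_safe[of k] by (force simp: safe_def)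
  have dec: "greedy_dist (token (st (m + i))) + i \<le> dist_bound" if "i \<le> Suc dist_bound" for i
    using that
  proof (induction i)
    case 0
    then show ?case using play_safe[of m] greedy_dist_le by (auto simp: safe_def)
  next
    case (Suc i)
    have "greedy_dist (token (st (Suc (m + i)))) < greedy_dist (token (st (m + i)))"
      using turn_outcome(4)[OF play_safe F_nonneg _ red_legal st_Suc, of "m + i"]
        never run[of i] Suc.prems no_surplus by auto
    then show ?case using Suc by simp
  qed
  from dec[of "Suc dist_bound"] show False by simp
qed

text \<open>The token never reaches \<open>r\<close>; if it did not reach \<open>b\<close> either, it would visit infinitely many
  different vertices.\<close>

lemma acyclic_wins:
  assumes "acyclic E"
  shows "\<exists>k. token (st k) = b"
proof (rule ccontr)
  assume never: "\<nexists>k. token (st k) = b"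
  have step: "(token (st k), token (st (Suc k))) \<in> E" for k
    using turn_outcome(2)[OF play_safe F_nonneg _ red_legal st_Suc] never by simp
  have path: "(token (st i), token (st j)) \<in> E\<^sup>+" if "i < j" for i j
    using that
  proof (induction j)
    case (Suc j)
    then show ?case using step[of j] by (cases "i = j") auto
  qed simp
  have "inj (\<lambda>k. token (st k))"
  proof (rule linorder_injI)
    show "token (st i) \<noteq> token (st j)" if "i < j" for i j
      using path[OF that] assms by (auto simp: acyclic_def)
  qed
  moreover have "range (\<lambda>k. token (st k)) \<subseteq> V" using play_safe by (auto simp: safe_def)
  ultimately show False using finite_V by (meson finite_imageD finite_subset infinite_UNIV_nat)
qed

end

end

section \<open>Long runs of heads\<close>

text \<open>
  Split the sequence of tosses after the first \<open>N + 1\<close>. If it has no run, then its first part is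
  not all heads and its second part has no run. The two parts are independent and the second is
  distributed like the whole sequence, so \<open>p \<le> (1 - q) * p\<close>, where \<open>p\<close> is the probability of having
  no run and \<open>q > 0\<close> that of starting with one; hence \<open>p = 0\<close>.
\<close>

lemma AE_coin_tosses_run: "AE \<omega> in coin_tosses. \<exists>m. \<forall>i\<le>N. \<omega> (m + i)"
proof -
  interpret sequence_space "measure_pmf (bernoulli_pmf (1 / 2))"
    by unfold_locales
  have space: "space S = UNIV" by (simp add: space_PiM)
  define heads where "heads = {\<omega> :: nat \<Rightarrow> bool. \<forall>i\<le>N. \<omega> i}"
  define no_run where "no_run = {\<omega> :: nat \<Rightarrow> bool. \<forall>m. \<exists>i\<le>N. \<not> \<omega> (m + i)}"
  have comp: "(\<lambda>\<omega> :: nat \<Rightarrow> bool. \<omega> k) \<in> measurable S (count_space UNIV)" for k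
    using measurable_component_singleton[of k UNIV "\<lambda>_. measure_pmf (bernoulli_pmf (1 / 2))"]
    by simp
  have "{\<omega> \<in> space S. \<forall>i\<le>N. \<omega> i} \<in> sets S"
    and "{\<omega> \<in> space S. \<forall>m. \<exists>i\<le>N. \<not> \<omega> (m + i)} \<in> sets S"
    using comp by measurable
  then have sets: "heads \<in> sets S" "no_run \<in> sets S"
    by (simp_all add: heads_def no_run_def space)
  have "emeasure S (prod_emb UNIV (\<lambda>_. measure_pmf (bernoulli_pmf (1 / 2))) {..N} (\<Pi>\<^sub>E j\<in>{..N}. {True}))
      = (\<Prod>j\<in>{..N}. emeasure (measure_pmf (bernoulli_pmf (1 / 2))) {True})"
    by (rule emeasure_PiM_emb) auto
  moreover have "prod_emb UNIV (\<lambda>_. measure_pmf (bernoulli_pmf (1 / 2))) {..N} (\<Pi>\<^sub>E j\<in>{..N}. {True}) = heads"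
    by (auto simp: prod_emb_def heads_def fun_eq_iff restrict_def split: if_splits)
  ultimately have "emeasure S heads = ennreal (1 / 2) ^ Suc N"
    by (simp add: emeasure_pmf_single)
  also have "\<dots> = ennreal ((1 / 2) ^ Suc N)"
    by (rule ennreal_power) simp
  finally have "prob heads = (1 / 2) ^ Suc N"
    by (rule measure_eq_emeasure_eq_ennreal[rotated]) simp
  then have heads_pos: "0 < prob heads" by (simp only: zero_less_power)
  have "emeasure S no_run = emeasure (distr (S \<Otimes>\<^sub>M S) S (\<lambda>(\<omega>, \<omega>'). comb_seq (Suc N) \<omega> \<omega>')) no_run"
    by (simp only: PiM_comb_seq)
  also have "\<dots> = emeasure (S \<Otimes>\<^sub>M S)
      ((\<lambda>(\<omega>, \<omega>'). comb_seq (Suc N) \<omega> \<omega>') -` no_run \<inter> space (S \<Otimes>\<^sub>M S))"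
    by (rule emeasure_distr[OF measurable_comb_seq sets(2)])
  also have "\<dots> \<le> emeasure (S \<Otimes>\<^sub>M S) ((space S - heads) \<times> no_run)"
  proof (rule emeasure_mono)
    show "(\<lambda>(\<omega>, \<omega>'). comb_seq (Suc N) \<omega> \<omega>') -` no_run \<inter> space (S \<Otimes>\<^sub>M S)
        \<subseteq> (space S - heads) \<times> no_run"
    proof (clarsimp simp: space no_run_def heads_def, intro conjI allI)
      fix \<omega> \<omega>' :: "nat \<Rightarrow> bool" and m
      assume *: "\<forall>m. \<exists>i\<le>N. \<not> comb_seq (Suc N) \<omega> \<omega>' (m + i)"
      show "\<exists>i\<le>N. \<not> \<omega> i" using *[rule_format, of 0] by (auto simp: comb_seq_def)
      show "\<exists>i\<le>N. \<not> \<omega>' (m + i)"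
        using *[rule_format, of "Suc N + m"] by (auto simp: comb_seq_def)
    qed
    show "(space S - heads) \<times> no_run \<in> sets (S \<Otimes>\<^sub>M S)"
      using sets by (intro pair_measureI) auto
  qed
  also have "\<dots> = emeasure S (space S - heads) * emeasure S no_run"
    using sets by (intro P.emeasure_pair_measure_Times) auto
  finally have "prob no_run \<le> (1 - prob heads) * prob no_run"
    using sets by (simp add: emeasure_eq_measure prob_compl flip: ennreal_mult)
  then have "prob heads * prob no_run \<le> 0" by (simp add: algebra_simps)
  then have "prob no_run = 0"
    using heads_pos measure_nonneg[of S no_run] by (simp add: mult_le_0_iff)
  then have "AE \<omega> in S. \<omega> \<notin> no_run"
    using sets(2) by (intro AE_not_in) (auto simp: null_sets_def emeasure_eq_measure)
  then show ?thesis unfolding coin_tosses_def by (simp add: no_run_def)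
qed

section \<open>Safety ratio greater than one\<close>

theorem theorem6:
  fixes V :: "'v set" and E :: "('v \<times> 'v) set" and b r v :: 'v
    and R :: "'v \<Rightarrow> real" and B :: real
  assumes "finite V" and "E \<subseteq> V \<times> V"
    and "b \<in> V" and "r \<in> V" and "b \<noteq> r"
    and "\<And>w. w \<in> V \<Longrightarrow> (w, b) \<in> E\<^sup>* \<or> (w, r) \<in> E\<^sup>*"
    and "richman_cost_function V E b r R"
    and "v \<in> V" and "0 \<le> B"
  shows "\<exists>\<sigma>. legal_strategy V E b r \<sigma> \<and>
           (\<forall>M\<ge>0. 0 < B + M \<and> safety_ratio R v B M > 1 \<longrightarrow>
              wins_with_probability_1 V E b r \<sigma> v B M \<and>
              (acyclic E \<longrightarrow> wins_definitely V E b r \<sigma> v B M))"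
proof -
  interpret richman_digraph V E b r R
    using assms by unfold_locales
  \<comment> \<open>Division by zero gives \<open>F = 0\<close> if \<open>R v = 0\<close>; any nonnegative value would do in that case.\<close>
  define F where "F = B / R v"
  have F: "0 \<le> F" using assms(9) R_bounds[OF assms(8)] by (simp add: F_def)
  let ?\<sigma> = "cautious_strategy F"
  have "wins_with_probability_1 V E b r ?\<sigma> v B M \<and>
      (acyclic E \<longrightarrow> wins_definitely V E b r ?\<sigma> v B M)"
    if M: "0 \<le> M" "0 < B + M" "safety_ratio R v B M > 1" for M
  proof -
    have safe: "safe F (B + M) (State v B M [])"
    proof (cases "R v = 0")
      case True
      then show ?thesis using assms M by (simp add: safe_def surplus_def)
    next
      case False
      then have pos: "0 < R v" using R_bounds[OF assms(8)] by simp
      have "1 < B / (B + M) / R v" using M(3) False by (simp add: safety_ratio_def)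
      also have "\<dots> = F / (B + M)" by (simp add: F_def)
      finally have "B + M < F" using M(2) by (simp add: less_divide_eq)
      then show ?thesis using assms M pos by (simp add: safe_def surplus_def F_def)
    qed
    have "AE \<omega> in coin_tosses. blue_wins b r ?\<sigma> \<rho> v B M \<omega>"
      if "legal_strategy V E b r \<rho>" for \<rho>
      using AE_coin_tosses_run[of dist_bound]
    proof (rule AE_mp, intro AE_I2 impI)
      fix \<omega> :: "nat \<Rightarrow> bool" assume "\<exists>m. \<forall>i\<le>dist_bound. \<omega> (m + i)"
      then show "blue_wins b r ?\<sigma> \<rho> v B M \<omega>"
        using run_of_heads_wins[OF F safe that] unfolding blue_wins_def by blast
    qed
    then show ?thesis
      using acyclic_wins[OF F safe]
      by (auto simp: wins_with_probability_1_def wins_definitely_def blue_wins_def)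
  qed
  then show ?thesis using legal_cautious_strategy by blast
qed

end
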